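(* Suppose $\gamma:\mathbb{R}\to\mathbb{R}^2$ is an open stationary solution to the curve diffusion flow. Then $\gamma$ is either a straight line, or a similarity transformation of the standard Cornu spiral. Up to translation and rotation such curves satisfy $\kappa(s)=k_2s+k_1$ for a pair $(k_1,k_2)\in\mathbb{R}^2$.
   Context: All curves are smooth and regular. $s$ denotes arc length along $\gamma$, $\nu$ a choice of unit normal, and $\kappa=\langle\gamma_{ss},\nu\rangle$ the curvature. The curve diffusion flow is $\langle\partial_t\gamma,\nu\rangle=-\kappa_{ss}$; a solution is stationary if it does not change in time, i.e. if $\kappa_{ss}\equiv0$. An open curve is a regular immersion $\gamma:\mathbb{R}\to\mathbb{R}^2$ for which there does not exist a pair of intervals $I,J$ with $I\cap J=\emptyset$, $|I|=\infty$, $|J|<\infty$ and $\gamma(I)=\gamma(J)$. The standard Cornu spiral (clothoid) is the curve with arc length parametrisation $s\mapsto\left(\int_0^s\cos(\pi t^2/2)\,dt,\ \int_0^s\sin(\pi t^2/2)\,dt\right)$, whose curvature is $\kappa(s)=\pi s$.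
   Formalization: The curve is additionally assumed to have infinite length at both ends (arc length ranges over all of R); without this, an open circular arc such as u -> (cos(arctan u), sin(arctan u)) is an open stationary curve that is neither a line nor a Cornu spiral. *)

theory Defs
  imports "HOL-Analysis.Analysis"
begin

section \<open>Regular smooth plane curves\<close>

definition smooth :: "(real \<Rightarrow> 'a::real_normed_vector) \<Rightarrow> bool" where
  "smooth f \<longleftrightarrow> (\<forall>n u. ((\<lambda>g u. vector_derivative g (at u)) ^^ n) f differentiable (at u))"

definition regular_curve :: "(real \<Rightarrow> real ^ 2) \<Rightarrow> bool" where
  "regular_curve \<gamma> \<longleftrightarrow> smooth \<gamma> \<and> (\<forall>u. vector_derivative \<gamma> (at u) \<noteq> 0)"

definition speed :: "(real \<Rightarrow> real ^ 2) \<Rightarrow> real \<Rightarrow> real" where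
  "speed \<gamma> u = norm (vector_derivative \<gamma> (at u))"

text \<open>The arc length parameter, signed and measured from the point with parameter 0
  (the interval integral changes sign when its bounds are exchanged).\<close>

definition arclength :: "(real \<Rightarrow> real ^ 2) \<Rightarrow> real \<Rightarrow> real" where
  "arclength \<gamma> u = (LBINT t=0..u. speed \<gamma> t)"

text \<open>Both ends of the curve have infinite length, so that the arc length parameter
  ranges over all of \<open>\<real>\<close>.\<close>

definition complete_curve :: "(real \<Rightarrow> real ^ 2) \<Rightarrow> bool" where
  "complete_curve \<gamma> \<longleftrightarrow>
     filterlim (arclength \<gamma>) at_top at_top \<and> filterlim (arclength \<gamma>) at_bot at_bot"

text \<open>Differentiation with respect to arc length along \<open>\<gamma>\<close>, of a quantity given as a function
  of the (arbitrary) curve parameter.\<close>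

definition d_ds :: "(real \<Rightarrow> real ^ 2) \<Rightarrow> (real \<Rightarrow> 'a::real_normed_vector) \<Rightarrow> real \<Rightarrow> 'a" where
  "d_ds \<gamma> f u = vector_derivative f (at u) /\<^sub>R speed \<gamma> u"

text \<open>The choice of unit normal is the unit tangent turned anticlockwise by a right angle;
  with it the Cornu spiral has curvature \<open>\<pi> s\<close>, see \<open>curvature_cornu\<close> below.\<close>

definition unit_normal :: "(real \<Rightarrow> real ^ 2) \<Rightarrow> real \<Rightarrow> real ^ 2" where
  "unit_normal \<gamma> u = vector [- (d_ds \<gamma> \<gamma> u $ 2), d_ds \<gamma> \<gamma> u $ 1]"

definition curvature :: "(real \<Rightarrow> real ^ 2) \<Rightarrow> real \<Rightarrow> real" where
  "curvature \<gamma> u = d_ds \<gamma> (d_ds \<gamma> \<gamma>) u \<bullet> unit_normal \<gamma> u"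

definition curvature_ss :: "(real \<Rightarrow> real ^ 2) \<Rightarrow> real \<Rightarrow> real" where
  "curvature_ss \<gamma> = d_ds \<gamma> (d_ds \<gamma> (curvature \<gamma>))"

section \<open>The curve diffusion flow\<close>

definition curve_diffusion_flow :: "(real \<Rightarrow> real \<Rightarrow> real ^ 2) \<Rightarrow> bool" where
  "curve_diffusion_flow \<Gamma> \<longleftrightarrow>
     (\<forall>t. regular_curve (\<Gamma> t)) \<and>
     (\<forall>t u. (\<lambda>t. \<Gamma> t u) differentiable (at t) \<and>
        vector_derivative (\<lambda>t. \<Gamma> t u) (at t) \<bullet> unit_normal (\<Gamma> t) u = - curvature_ss (\<Gamma> t) u)"

definition stationary :: "(real \<Rightarrow> real ^ 2) \<Rightarrow> bool" where
  "stationary \<gamma> \<longleftrightarrow> curve_diffusion_flow (\<lambda>t. \<gamma>)"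

lemma stationary_iff: "stationary \<gamma> \<longleftrightarrow> regular_curve \<gamma> \<and> (\<forall>u. curvature_ss \<gamma> u = 0)"
  unfolding stationary_def curve_diffusion_flow_def by auto

section \<open>Open curves\<close>

text \<open>Here \<open>emeasure lborel\<close> is the length of a parameter interval. For complete curves an
  interval has finite length in the parameter if and only if it has finite arc length.\<close>

definition open_curve :: "(real \<Rightarrow> real ^ 2) \<Rightarrow> bool" where
  "open_curve \<gamma> \<longleftrightarrow> regular_curve \<gamma> \<and>
     \<not> (\<exists>I J. is_interval I \<and> is_interval J \<and> I \<inter> J = {} \<and>
          emeasure lborel I = \<infinity> \<and> emeasure lborel J < \<infinity> \<and> \<gamma> ` I = \<gamma> ` J)"

section \<open>Lines, similarities and the Cornu spiral\<close>

definition reparametrisation :: "(real \<Rightarrow> real) \<Rightarrow> bool" where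
  "reparametrisation \<phi> \<longleftrightarrow> smooth \<phi> \<and> bij \<phi> \<and> (\<forall>u. vector_derivative \<phi> (at u) \<noteq> 0)"

definition same_curve :: "(real \<Rightarrow> real ^ 2) \<Rightarrow> (real \<Rightarrow> real ^ 2) \<Rightarrow> bool" where
  "same_curve \<gamma> \<delta> \<longleftrightarrow> (\<exists>\<phi>. reparametrisation \<phi> \<and> \<gamma> = \<delta> \<circ> \<phi>)"

definition straight_line :: "(real \<Rightarrow> real ^ 2) \<Rightarrow> bool" where
  "straight_line \<gamma> \<longleftrightarrow> (\<exists>p v. v \<noteq> 0 \<and> same_curve \<gamma> (\<lambda>s. p + s *\<^sub>R v))"

text \<open>Orientation reversing similarities are included; they are needed for curves whose
  curvature decreases along the curve.\<close>

definition similarity :: "(real ^ 2 \<Rightarrow> real ^ 2) \<Rightarrow> bool" where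
  "similarity F \<longleftrightarrow> (\<exists>r>0. \<forall>x y. dist (F x) (F y) = r * dist x y)"

definition cornu :: "real \<Rightarrow> real ^ 2" where
  "cornu s = vector [LBINT t=0..s. cos (pi * t\<^sup>2 / 2), LBINT t=0..s. sin (pi * t\<^sup>2 / 2)]"

lemma has_real_derivative_LBINT:
  fixes f :: "real \<Rightarrow> real"
  assumes "continuous_on UNIV f"
  shows "((\<lambda>u. LBINT t=0..u. f t) has_real_derivative f x) (at x)"
proof -
  let ?a = "min 0 x - 1" and ?b = "max 0 x + 1"
  have "continuous_on {?a..?b} f"
    using assms continuous_on_subset by blast
  then have "((\<lambda>u. LBINT t=ereal 0..ereal u. f t) has_vector_derivative f x) (at x within {?a..?b})"
    by (intro interval_integral_FTC2) linarith+
  then have "((\<lambda>u. LBINT t=0..u. f t) has_vector_derivative f x) (at x within {?a<..<?b})"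
    unfolding zero_ereal_def by (rule has_vector_derivative_within_subset) (simp add: greaterThanLessThan_subseteq_atLeastAtMost_iff)
  moreover have "x \<in> {?a<..<?b}"
    by auto
  ultimately show ?thesis
    by (simp only: has_real_derivative_iff_has_vector_derivative
        has_vector_derivative_within_open[OF _ open_greaterThanLessThan])
qed

lemma has_vector_derivative_vector_2:
  fixes f g :: "real \<Rightarrow> real"
  assumes "(f has_real_derivative f') (at x)" "(g has_real_derivative g') (at x)"
  shows "((\<lambda>u. vector [f u, g u] :: real ^ 2) has_vector_derivative vector [f', g']) (at x)"
proof -
  have *: "(vector [a, b] :: real ^ 2) = a *\<^sub>R axis 1 1 + b *\<^sub>R axis 2 1" for a b
    by (simp add: vec_eq_iff forall_2 axis_def)
  have "((\<lambda>u. h u *\<^sub>R c) has_vector_derivative h' *\<^sub>R c) (at x)"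
    if "(h has_real_derivative h') (at x)" for h h' and c :: "real ^ 2"
    using has_vector_derivative_scaleR[OF that has_vector_derivative_const[of c]] by simp
  then show ?thesis
    unfolding * using assms by (intro has_vector_derivative_add)
qed

lemma curvature_cornu: "curvature cornu s = pi * s"
proof -
  have v: "vector_derivative cornu (at u) = vector [cos (pi * u\<^sup>2 / 2), sin (pi * u\<^sup>2 / 2)]" for u
    unfolding cornu_def
    by (intro vector_derivative_at has_vector_derivative_vector_2 has_real_derivative_LBINT
        continuous_intros) auto
  have sp: "speed cornu u = 1" for u
    unfolding speed_def v by (simp add: norm_vec_def L2_set_def sum_2)
  have T: "d_ds cornu cornu = (\<lambda>u. vector [cos (pi * u\<^sup>2 / 2), sin (pi * u\<^sup>2 / 2)])"
    by (rule ext) (simp add: d_ds_def sp v)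
  have "vector_derivative (d_ds cornu cornu) (at s) =
      vector [- (pi * s) * sin (pi * s\<^sup>2 / 2), pi * s * cos (pi * s\<^sup>2 / 2)]"
    unfolding T
    by (intro vector_derivative_at has_vector_derivative_vector_2;
        (rule derivative_eq_intros refl | simp)+)
  then have "d_ds cornu (d_ds cornu cornu) s =
      vector [- (pi * s) * sin (pi * s\<^sup>2 / 2), pi * s * cos (pi * s\<^sup>2 / 2)]"
    unfolding d_ds_def[of _ "d_ds cornu cornu"] sp by simp
  then have "curvature cornu s =
      pi * s * (sin (pi * s\<^sup>2 / 2))\<^sup>2 + pi * s * (cos (pi * s\<^sup>2 / 2))\<^sup>2"
    unfolding curvature_def unit_normal_def
    by (simp only: T inner_vec_def sum_2 vector_2 inner_real_def power2_eq_square) simp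
  then show ?thesis
    by (simp flip: distrib_left)
qed

end

theory Submission
  imports Defs
begin

text \<open>A stationary curve has \<open>\<kappa> = k2 s + k1\<close>, so the unit tangent turns at the same rate as
  \<open>(cos \<theta>, sin \<theta>)\<close> with \<open>\<theta> = k2 s\<^sup>2 / 2 + k1 s\<close>, and the two differ by a fixed rotation.
  Integrating, the curve is a rigid motion of a model curve that depends on \<open>k1\<close> and \<open>k2\<close> only.
  For \<open>k1 = k2 = 0\<close> the model is a line; for \<open>k2 = 0 \<noteq> k1\<close> it is a circle, and a complete circle
  is not open because one turn has the same image as the half-infinite remainder; for \<open>k2 \<noteq> 0\<close>
  completing the square turns it into the Cornu spiral, reflected if \<open>k2 < 0\<close>.\<close>

section \<open>Closure properties of smooth functions\<close>

text \<open>A finite-order counterpart of \<open>smooth\<close>. Since the recursion passes to the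
  derivative, closure properties follow by induction on the order with the function left
  general.\<close>

primrec diff_times :: "nat \<Rightarrow> (real \<Rightarrow> 'a::real_normed_vector) \<Rightarrow> bool" where
  "diff_times 0 f \<longleftrightarrow> True"
| "diff_times (Suc n) f \<longleftrightarrow>
     (\<forall>u. f differentiable (at u)) \<and> diff_times n (\<lambda>u. vector_derivative f (at u))"

lemma diff_times_iff:
  "diff_times n f \<longleftrightarrow>
     (\<forall>m<n. \<forall>u. ((\<lambda>g u. vector_derivative g (at u)) ^^ m) f differentiable (at u))"
  \<comment> \<open>The iterate is unfolded from the inside, as in the recursion of
    \<open>diff_times\<close>; its default unfolding from the outside is switched off.\<close>
  by (induction n arbitrary: f) (auto simp: All_less_Suc2 funpow_Suc_right simp del: funpow.simps)

lemma smooth_iff_diff_times: "smooth f \<longleftrightarrow> (\<forall>n. diff_times n f)"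
  unfolding smooth_def diff_times_iff by (metis lessI)

lemma diff_times_SucD: "diff_times (Suc n) f \<Longrightarrow> diff_times n f"
  by (induction n arbitrary: f) auto

text \<open>Vector derivatives on the line are unique, so any explicit formula for the derivative
  may stand in for \<open>vector_derivative\<close>.\<close>

lemma diff_times_SucI:
  assumes "\<And>u. (f has_vector_derivative f' u) (at u)" "diff_times n f'"
  shows "diff_times (Suc n) f"
proof -
  have "(\<lambda>u. vector_derivative f (at u)) = f'"
    using assms(1) by (auto intro: vector_derivative_at)
  then show ?thesis
    using assms by (auto intro: differentiableI_vector)
qed

lemma diff_times_Suc_deriv:
  assumes "diff_times (Suc n) f"
  shows "(f has_vector_derivative vector_derivative f (at u)) (at u)"
  using assms by (simp add: vector_derivative_works)

lemma diff_times_add: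
  "diff_times n f \<Longrightarrow> diff_times n g \<Longrightarrow> diff_times n (\<lambda>u. f u + g u)"
proof (induction n arbitrary: f g)
  case (Suc n)
  show ?case
    by (rule diff_times_SucI[OF has_vector_derivative_add])
      (use Suc in \<open>auto simp: vector_derivative_works\<close>)
qed simp

lemma diff_times_bounded_linear:
  assumes "bounded_linear h"
  shows "diff_times n f \<Longrightarrow> diff_times n (\<lambda>u. h (f u))"
proof (induction n arbitrary: f)
  case (Suc n)
  show ?case
  proof (rule diff_times_SucI[OF bounded_linear.has_vector_derivative[OF assms]])
    show "diff_times n (\<lambda>u. h (vector_derivative f (at u)))"
      using Suc.prems by (intro Suc.IH) simp
  qed (rule diff_times_Suc_deriv[OF Suc.prems])
qed simp

text \<open>Leibniz rule: each summand of the derivative pairs one differentiated factor with one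
  untouched factor, and both have the lower order required by the induction hypothesis.\<close>

lemma diff_times_bilinear:
  assumes "bounded_bilinear h"
  shows "diff_times n f \<Longrightarrow> diff_times n g \<Longrightarrow> diff_times n (\<lambda>u. h (f u) (g u))"
proof (induction n arbitrary: f g)
  case (Suc n)
  show ?case
  proof (rule diff_times_SucI[OF bounded_bilinear.has_vector_derivative[OF assms]])
    show "diff_times n (\<lambda>u. h (f u) (vector_derivative g (at u)) + h (vector_derivative f (at u)) (g u))"
      using Suc.prems Suc.prems[THEN diff_times_SucD] by (intro diff_times_add Suc.IH) simp_all
  qed (rule Suc.prems[THEN diff_times_Suc_deriv])+
qed simp

lemma diff_times_const: "diff_times n (\<lambda>u. c)"
proof (induction n arbitrary: c)
  case (Suc n)
  show ?case
    by (rule diff_times_SucI[OF has_vector_derivative_const]) (rule Suc)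
qed simp

lemmas diff_times_mult = diff_times_bilinear[OF bounded_bilinear_mult]

text \<open>The derivative -f'/f^2 is a product of f' with two copies of 1/f, to which the induction
  hypothesis applies for the same f.\<close>

lemma diff_times_inverse:
  fixes f :: "real \<Rightarrow> real"
  assumes "\<And>u. f u \<noteq> 0"
  shows "diff_times n f \<Longrightarrow> diff_times n (\<lambda>u. inverse (f u))"
proof (induction n)
  case (Suc n)
  show ?case
  proof (rule diff_times_SucI)
    fix u
    show "((\<lambda>u. inverse (f u)) has_vector_derivative
        (inverse (f u) * vector_derivative f (at u)) * (- 1 * inverse (f u))) (at u)"
      unfolding has_real_derivative_iff_has_vector_derivative[symmetric]
      by (rule DERIV_cong[OF DERIV_inverse'])
        (use diff_times_Suc_deriv[OF Suc.prems] assms in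
          \<open>auto simp: has_real_derivative_iff_has_vector_derivative\<close>)
    show "diff_times n (\<lambda>u. (inverse (f u) * vector_derivative f (at u)) * (- 1 * inverse (f u)))"
      using Suc diff_times_SucD[of n f] by (intro diff_times_mult diff_times_const) auto
  qed
qed simp

text \<open>The derivative f'/(2 sqrt f) contains the square root only through its inverse, so the
  induction hypothesis and \<open>diff_times_inverse\<close> suffice.\<close>

lemma diff_times_sqrt:
  fixes f :: "real \<Rightarrow> real"
  assumes "\<And>u. f u > 0"
  shows "diff_times n f \<Longrightarrow> diff_times n (\<lambda>u. sqrt (f u))"
proof (induction n)
  case (Suc n)
  have nz: "sqrt (f u) \<noteq> 0" for u
    using assms[of u] by simp
  show ?case
  proof (rule diff_times_SucI)
    fix u
    have "(f has_real_derivative vector_derivative f (at u)) (at u)"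
      using diff_times_Suc_deriv[OF Suc.prems]
      by (simp add: has_real_derivative_iff_has_vector_derivative)
    from DERIV_chain2[OF DERIV_real_sqrt[OF assms] this]
    show "((\<lambda>u. sqrt (f u)) has_vector_derivative
        inverse (sqrt (f u)) * (1 / 2) * vector_derivative f (at u)) (at u)"
      by (simp add: has_real_derivative_iff_has_vector_derivative field_simps)
    show "diff_times n (\<lambda>u. inverse (sqrt (f u)) * (1 / 2) * vector_derivative f (at u))"
      using Suc diff_times_SucD[of n f] nz
      by (intro diff_times_mult diff_times_const diff_times_inverse) auto
  qed
qed simp

section \<open>Smoothness of all orders\<close>

lemma smooth_deriv:
  assumes "smooth f"
  shows "(f has_vector_derivative vector_derivative f (at u)) (at u)"
  using assms by (intro diff_times_Suc_deriv[of 0]) (simp only: smooth_iff_diff_times)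

lemma smooth_vector_derivative: "smooth f \<Longrightarrow> smooth (\<lambda>u. vector_derivative f (at u))"
  unfolding smooth_iff_diff_times by (auto dest: spec[of _ "Suc _"])

lemma smoothI:
  assumes "\<And>u. (f has_vector_derivative f' u) (at u)" "smooth f'"
  shows "smooth f"
  unfolding smooth_iff_diff_times
proof
  fix n
  have "diff_times n f'"
    using assms(2) by (simp add: smooth_iff_diff_times)
  then show "diff_times n f"
    by (rule diff_times_SucD[OF diff_times_SucI[OF assms(1)]])
qed

lemma smooth_bounded_linear: "bounded_linear h \<Longrightarrow> smooth f \<Longrightarrow> smooth (\<lambda>u. h (f u))"
  unfolding smooth_iff_diff_times by (simp add: diff_times_bounded_linear)

lemma smooth_bilinear:
  "bounded_bilinear h \<Longrightarrow> smooth f \<Longrightarrow> smooth g \<Longrightarrow> smooth (\<lambda>u. h (f u) (g u))"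
  unfolding smooth_iff_diff_times by (simp add: diff_times_bilinear)

lemma smooth_const: "smooth (\<lambda>u. c)"
  unfolding smooth_iff_diff_times by (simp add: diff_times_const)

lemma smooth_add: "smooth f \<Longrightarrow> smooth g \<Longrightarrow> smooth (\<lambda>u. f u + g u)"
  unfolding smooth_iff_diff_times by (simp add: diff_times_add)

lemma smooth_inverse:
  fixes f :: "real \<Rightarrow> real"
  shows "(\<And>u. f u \<noteq> 0) \<Longrightarrow> smooth f \<Longrightarrow> smooth (\<lambda>u. inverse (f u))"
  unfolding smooth_iff_diff_times by (simp add: diff_times_inverse)

text \<open>The norm is the square root of an inner product that stays positive because f never
  vanishes.\<close>

lemma smooth_norm:
  fixes f :: "real \<Rightarrow> 'a::real_inner"
  assumes "\<And>u. f u \<noteq> 0" "smooth f"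
  shows "smooth (\<lambda>u. norm (f u))"
  using assms unfolding smooth_iff_diff_times norm_eq_sqrt_inner
  by (intro allI diff_times_sqrt diff_times_bilinear[OF bounded_bilinear_inner]) auto

section \<open>Frames in the plane\<close>

text \<open>Multiplication by i in the complex plane; \<open>unit_normal\<close> is its value at the
  unit tangent.\<close>

definition rot90 :: "real ^ 2 \<Rightarrow> real ^ 2" where
  "rot90 x = vector [- (x $ 2), x $ 1]"

text \<open>A rotation once a^2 + b^2 = 1. It is given by cosine and sine because the proof finds
  these as inner products and never chooses an angle.\<close>

definition rot_mat :: "real \<Rightarrow> real \<Rightarrow> real ^ 2 ^ 2" where
  "rot_mat a b = vector [vector [a, - b], vector [b, a]]"

definition unit_at :: "real \<Rightarrow> real ^ 2" where
  "unit_at t = vector [cos t, sin t]"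

lemmas plane_simps = vec_eq_iff forall_2 inner_vec_def sum_2 rot90_def rot_mat_def unit_at_def
  matrix_vector_mult_def

lemma bounded_linear_rot90: "bounded_linear rot90"
  unfolding linear_conv_bounded_linear[symmetric]
  by (rule linearI) (simp_all add: plane_simps)

text \<open>A unit vector and its quarter turn form an orthonormal basis of the plane.\<close>

lemma rot90_expansion:
  assumes "norm x = 1"
  shows "y = (y \<bullet> x) *\<^sub>R x + (y \<bullet> rot90 x) *\<^sub>R rot90 x"
proof -
  have "x $ 1 * x $ 1 + x $ 2 * x $ 2 = 1"
    using assms by (simp add: norm_eq_1 inner_vec_def sum_2)
  then have "y $ 1 * (x $ 1 * x $ 1 + x $ 2 * x $ 2) = y $ 1"
    "y $ 2 * (x $ 1 * x $ 1 + x $ 2 * x $ 2) = y $ 2"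
    by simp_all
  then show ?thesis
    by (simp add: plane_simps algebra_simps)
qed

lemma norm_unit_at [simp]: "norm (unit_at t) = 1"
  by (simp add: norm_eq_1 plane_simps flip: power2_eq_square)

lemma has_vector_derivative_unit_at:
  assumes "(f has_real_derivative f') (at x)"
  shows "((\<lambda>u. unit_at (f u)) has_vector_derivative f' *\<^sub>R rot90 (unit_at (f x))) (at x)"
proof -
  have "f' *\<^sub>R rot90 (unit_at (f x)) = vector [- sin (f x) * f', cos (f x) * f']"
    by (simp add: plane_simps)
  then show ?thesis
    unfolding unit_at_def
    by (simp only:) (intro has_vector_derivative_vector_2 DERIV_fun_cos DERIV_fun_sin assms)
qed

lemma rotation_matrix_rot_mat:
  assumes "a\<^sup>2 + b\<^sup>2 = 1"
  shows "rotation_matrix (rot_mat a b)"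
  unfolding rotation_matrix_def orthogonal_matrix det_2
  using assms
  by (simp add: matrix_matrix_mult_def transpose_def mat_def vec_eq_iff forall_2 sum_2 rot_mat_def
      power2_eq_square algebra_simps)

lemma norm_rot_mat:
  assumes "a\<^sup>2 + b\<^sup>2 = 1"
  shows "norm (rot_mat a b *v x) = norm x"
proof -
  have "orthogonal_transformation ((*v) (rot_mat a b))"
    using rotation_matrix_rot_mat[OF assms]
    by (simp add: rotation_matrix_def orthogonal_transformation_matrix)
  then show ?thesis
    by (rule orthogonal_transformation_norm)
qed

text \<open>The difference of f and h after g has zero derivative, hence is constant. All later
  integrations, of curvature and of curves alike, go through this lemma.\<close>

lemma eq_affine_image_if_deriv_eq:
  fixes f :: "real \<Rightarrow> 'a::real_normed_vector" and g :: "real \<Rightarrow> 'b::real_normed_vector"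
  assumes h: "bounded_linear h"
    and f: "\<And>u. (f has_vector_derivative h (g' u)) (at u)"
    and g: "\<And>u. (g has_vector_derivative g' u) (at u)"
  shows "f u = f 0 + h (g u - g 0)"
proof -
  have "((\<lambda>u. f u - h (g u)) has_vector_derivative 0) (at u)" for u
    using has_vector_derivative_diff[OF f bounded_linear.has_vector_derivative[OF h g]] by simp
  then obtain c where "f u - h (g u) = c" for u
    using has_vector_derivative_zero_constant[of UNIV "\<lambda>u. f u - h (g u)"] by auto
  then have "f u - h (g u) = f 0 - h (g 0)"
    by metis
  then show ?thesis
    using bounded_linear.linear[OF h] by (simp add: linear_diff algebra_simps)
qed

section \<open>The model curves\<close>

text \<open>The arc length curve from the origin whose tangent angle is the antiderivative of k2 s +
  k1 vanishing at 0. The case k1 = 0, k2 = \<pi> is \<open>cornu\<close>.\<close>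

definition clothoid :: "real \<Rightarrow> real \<Rightarrow> real \<Rightarrow> real ^ 2" where
  "clothoid k1 k2 s =
     vector [LBINT t=0..s. cos (k2 * t\<^sup>2 / 2 + k1 * t), LBINT t=0..s. sin (k2 * t\<^sup>2 / 2 + k1 * t)]"

lemma clothoid_deriv:
  "(clothoid k1 k2 has_vector_derivative unit_at (k2 * s\<^sup>2 / 2 + k1 * s)) (at s)"
  unfolding clothoid_def unit_at_def
  by (intro has_vector_derivative_vector_2 has_real_derivative_LBINT continuous_intros) auto

lemma clothoid_0 [simp]: "clothoid k1 k2 0 = 0"
  by (simp add: clothoid_def plane_simps flip: zero_ereal_def)

lemma cornu_deriv: "(cornu has_vector_derivative unit_at (pi * s\<^sup>2 / 2)) (at s)"
  unfolding cornu_def unit_at_def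
  by (intro has_vector_derivative_vector_2 has_real_derivative_LBINT continuous_intros) auto

lemma clothoid_line: "clothoid 0 0 s = s *\<^sub>R unit_at 0"
proof -
  have "clothoid 0 0 s = clothoid 0 0 0 + (s *\<^sub>R unit_at 0 - 0 *\<^sub>R unit_at 0)"
    by (rule eq_affine_image_if_deriv_eq[where h = "\<lambda>x. x" and g' = "\<lambda>u. unit_at 0"])
      (use clothoid_deriv[of 0 0] in \<open>auto intro!: derivative_eq_intros\<close>)
  then show ?thesis
    by simp
qed

lemma clothoid_circle_periodic:
  assumes "k1 \<noteq> 0"
  shows "clothoid k1 0 (s + of_int n * (2 * pi / k1)) = clothoid k1 0 s"
proof -
  \<comment> \<open>Closed form of a circle of radius 1/|k1|: as \<open>rot90\<close> squares to -1,
    the multiple -1/k1 of \<open>rot90 (unit_at (k1 * s))\<close> is an antiderivative of the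
    tangent.\<close>
  have *: "clothoid k1 0 s = (1 / k1) *\<^sub>R rot90 (unit_at 0 - unit_at (k1 * s))" for s
  proof -
    have lin: "bounded_linear (\<lambda>x. (1 / k1) *\<^sub>R rot90 (- x))"
      by (intro bounded_linear_compose[OF bounded_linear_scaleR_right]
          bounded_linear_compose[OF bounded_linear_rot90] bounded_linear_minus bounded_linear_ident)
    have "clothoid k1 0 s =
        clothoid k1 0 0 + (1 / k1) *\<^sub>R rot90 (- (unit_at (k1 * s) - unit_at (k1 * 0)))"
    proof (rule eq_affine_image_if_deriv_eq[OF lin])
      fix u
      show "((\<lambda>u. unit_at (k1 * u)) has_vector_derivative k1 *\<^sub>R rot90 (unit_at (k1 * u))) (at u)"
        by (rule has_vector_derivative_unit_at) (auto intro!: derivative_eq_intros)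
      have "(1 / k1) *\<^sub>R rot90 (- (k1 *\<^sub>R rot90 (unit_at (k1 * u)))) = unit_at (k1 * u)"
        using assms by (simp add: plane_simps)
      then show "(clothoid k1 0 has_vector_derivative
          (1 / k1) *\<^sub>R rot90 (- (k1 *\<^sub>R rot90 (unit_at (k1 * u))))) (at u)"
        using clothoid_deriv[of k1 0 u] by simp
    qed
    then show ?thesis
      by simp
  qed
  have "k1 * (s + of_int n * (2 * pi / k1)) = k1 * s + 2 * pi * of_int n"
    using assms by (simp add: field_simps)
  moreover have "unit_at (k1 * s + 2 * pi * of_int n) = unit_at (k1 * s)"
    by (simp add: unit_at_def cos_add sin_add)
  ultimately show ?thesis
    unfolding * by simp
qed

text \<open>Completing the square gives the angle k2 (s + k1/k2)^2 / 2 - k1^2 / (2 k2). Scaling by r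
  turns |k2| into \<pi>, a reflection supplies the sign of k2, and a rotation supplies the constant
  term.\<close>

lemma clothoid_eq_cornu:
  fixes k1 k2 :: real
  defines "r \<equiv> sqrt (\<bar>k2\<bar> / pi)"
  assumes "k2 \<noteq> 0"
  obtains h where "linear h" "\<And>x. norm (h x) = norm x"
    "\<And>s. clothoid k1 k2 s = (1 / r) *\<^sub>R h (cornu (r * s + r * k1 / k2) - cornu (r * k1 / k2))"
proof -
  \<comment> \<open>The sign \<epsilon> decides whether h reflects in the first axis; c is the
    constant term left by completing the square.\<close>
  define \<epsilon> where "\<epsilon> = sgn k2"
  define c where "c = - (k1\<^sup>2 / (2 * k2))"
  define h :: "real ^ 2 \<Rightarrow> real ^ 2"
    where "h x = rot_mat (cos c) (sin c) *v vector [x $ 1, \<epsilon> * x $ 2]" for x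
  have \<epsilon>: "\<epsilon> = 1 \<or> \<epsilon> = - 1" "\<epsilon> * \<bar>k2\<bar> = k2"
    using assms by (auto simp: \<epsilon>_def sgn_if)
  have r: "r > 0" "r\<^sup>2 = \<bar>k2\<bar> / pi"
    using assms by (simp_all add: r_def)
  have lin: "linear h"
    by (rule linearI) (simp_all add: h_def plane_simps algebra_simps)
  have "norm (h x) = norm x" for x
  proof -
    have "norm (h x) = norm (vector [x $ 1, \<epsilon> * x $ 2] :: real ^ 2)"
      unfolding h_def using norm_rot_mat by simp
    also have "\<dots> = norm x"
      using \<epsilon>(1) by (auto simp: norm_eq_sqrt_inner plane_simps)
    finally show ?thesis .
  qed
  \<comment> \<open>On unit vectors h acts on the angle: reflection multiplies it by \<epsilon>,
    rotation adds c.\<close>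
  moreover have h_unit: "h (unit_at t) = unit_at (c + \<epsilon> * t)" for t
    using \<epsilon>(1) by (auto simp: h_def plane_simps cos_add sin_add cos_diff sin_diff)
  have lin': "bounded_linear (\<lambda>x. (1 / r) *\<^sub>R h x)"
    using lin by (intro bounded_linear_compose[OF bounded_linear_scaleR_right])
      (simp add: linear_conv_bounded_linear)
  have "clothoid k1 k2 s = clothoid k1 k2 0 +
      (1 / r) *\<^sub>R h (cornu (r * s + r * k1 / k2) - cornu (r * 0 + r * k1 / k2))" for s
  proof (rule eq_affine_image_if_deriv_eq[OF lin'])
    fix s
    let ?t = "r * s + r * k1 / k2"
    have "((\<lambda>s. r * s + r * k1 / k2) has_vector_derivative r) (at s)"
      unfolding has_real_derivative_iff_has_vector_derivative[symmetric]
      by (auto intro!: derivative_eq_intros)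
    from vector_diff_chain_at[OF this cornu_deriv]
    show "((\<lambda>s. cornu (r * s + r * k1 / k2)) has_vector_derivative
        r *\<^sub>R unit_at (pi * ?t\<^sup>2 / 2)) (at s)"
      by (simp add: o_def)
    \<comment> \<open>The shift r k1/k2 was chosen so that r factors out and the square is the
      completed one.\<close>
    have "?t\<^sup>2 = r\<^sup>2 * (s + k1 / k2)\<^sup>2"
      by (simp add: power2_eq_square algebra_simps)
    then have "\<epsilon> * (pi * ?t\<^sup>2 / 2) = (\<epsilon> * \<bar>k2\<bar>) * (s + k1 / k2)\<^sup>2 / 2"
      by (simp add: r)
    also have "\<dots> = k2 * s\<^sup>2 / 2 + k1 * s - c"
      using assms by (simp add: \<epsilon> c_def power2_eq_square field_simps)
    finally have "(1 / r) *\<^sub>R h (r *\<^sub>R unit_at (pi * ?t\<^sup>2 / 2)) = unit_at (k2 * s\<^sup>2 / 2 + k1 * s)"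
      using r by (simp add: linear_scale[OF lin] h_unit diff_divide_distrib add_divide_distrib)
    then show "(clothoid k1 k2 has_vector_derivative
        (1 / r) *\<^sub>R h (r *\<^sub>R unit_at (pi * ?t\<^sup>2 / 2))) (at s)"
      using clothoid_deriv by simp
  qed
  ultimately show ?thesis
    by (intro that[OF lin]) simp_all
qed

lemma emeasure_lborel_atLeast: "emeasure lborel {a::real..} = \<infinity>"
proof (rule ccontr)
  assume "emeasure lborel {a..} \<noteq> \<infinity>"
  then obtain x where x: "emeasure lborel {a..} = ennreal x" "x \<ge> 0"
    by (cases "emeasure lborel {a..}") auto
  \<comment> \<open>If the half-line had finite length x, it would contain an interval of length x +
    1.\<close>
  have "emeasure lborel {a..a + (x + 1)} \<le> emeasure lborel {a..}"
    by (rule emeasure_mono) auto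
  then have "x + 1 \<le> x"
    using x by simp
  then show False
    by simp
qed

section \<open>Curves in arc length\<close>

locale regular_plane_curve =
  fixes \<gamma> :: "real \<Rightarrow> real ^ 2"
  assumes regular: "regular_curve \<gamma>"
begin

lemma smooth_curve: "smooth \<gamma>"
  using regular by (simp add: regular_curve_def)

lemma speed_pos: "speed \<gamma> u > 0"
  using regular by (simp add: regular_curve_def speed_def)

lemma smooth_speed: "smooth (speed \<gamma>)"
  unfolding speed_def
  by (rule smooth_norm[OF _ smooth_vector_derivative[OF smooth_curve]])
    (use regular in \<open>simp add: regular_curve_def\<close>)

lemma smooth_d_ds: "smooth f \<Longrightarrow> smooth (d_ds \<gamma> f)"
  unfolding d_ds_def
  by (intro smooth_bilinear[OF bounded_bilinear_scaleR] smooth_inverse smooth_speed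
      smooth_vector_derivative) (simp_all add: less_imp_neq[OF speed_pos, symmetric])

text \<open>Cleared of the division by speed, an arc length derivative becomes an ordinary one, so
  the curve need not be reparametrised first.\<close>

lemma d_ds_deriv:
  assumes "smooth f"
  shows "(f has_vector_derivative speed \<gamma> u *\<^sub>R d_ds \<gamma> f u) (at u)"
  using smooth_deriv[OF assms, of u] speed_pos[of u] by (simp add: d_ds_def)

lemma smooth_curvature: "smooth (curvature \<gamma>)"
  unfolding curvature_def unit_normal_def rot90_def[symmetric]
  by (intro smooth_bilinear[OF bounded_bilinear_inner] smooth_d_ds
      smooth_bounded_linear[OF bounded_linear_rot90] smooth_curve)

section \<open>Arc length as a change of parameter\<close>

lemma arclength_deriv: "(arclength \<gamma> has_real_derivative speed \<gamma> u) (at u)"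
proof -
  have "continuous_on UNIV (speed \<gamma>)"
    using smooth_deriv[OF smooth_speed]
    by (auto intro!: continuous_at_imp_continuous_on has_vector_derivative_continuous)
  then show ?thesis
    unfolding arclength_def by (rule has_real_derivative_LBINT)
qed

lemma arclength_0 [simp]: "arclength \<gamma> 0 = 0"
  by (simp add: arclength_def flip: zero_ereal_def)

lemma smooth_arclength: "smooth (arclength \<gamma>)"
  by (rule smoothI[OF _ smooth_speed])
    (use arclength_deriv in \<open>simp add: has_real_derivative_iff_has_vector_derivative\<close>)

lemma strict_mono_arclength: "strict_mono (arclength \<gamma>)"
proof (rule strict_monoI)
  fix x y :: real
  assume "x < y"
  then show "arclength \<gamma> x < arclength \<gamma> y"
    by (rule DERIV_pos_imp_increasing) (use arclength_deriv speed_pos in blast)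
qed

lemma surj_arclength:
  assumes "complete_curve \<gamma>"
  shows "surj (arclength \<gamma>)"
  unfolding surj_def
proof
  fix y :: real
  have "eventually (\<lambda>u. y \<le> arclength \<gamma> u) at_top" "eventually (\<lambda>u. arclength \<gamma> u \<le> y) at_bot"
    using assms by (auto simp: complete_curve_def filterlim_at_top filterlim_at_bot)
  then obtain a b where ab: "arclength \<gamma> a \<le> y" "y \<le> arclength \<gamma> b"
    unfolding eventually_at_top_linorder eventually_at_bot_linorder by blast
  then have "a \<le> b"
    using strict_mono_arclength by (meson order_trans strict_mono_less_eq)
  then show "\<exists>x. y = arclength \<gamma> x"
    using IVT[of "arclength \<gamma>" a y b] ab arclength_deriv DERIV_isCont by blast
qed

text \<open>Supplies the parameter changes for \<open>same_curve\<close>: arc length itself for the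
  line, a scaled and shifted arc length for the Cornu spiral.\<close>

lemma reparametrisation_affine_arclength:
  assumes "complete_curve \<gamma>" "a \<noteq> 0"
  shows "reparametrisation (\<lambda>u. a * arclength \<gamma> u + c)"
proof -
  have "((\<lambda>u. a * arclength \<gamma> u + c) has_real_derivative a * speed \<gamma> u) (at u)" for u
    using arclength_deriv by (auto intro!: derivative_eq_intros)
  then have "vector_derivative (\<lambda>u. a * arclength \<gamma> u + c) (at u) = a * speed \<gamma> u" for u
    by (simp add: has_real_derivative_iff_has_vector_derivative vector_derivative_at)
  moreover have "smooth (\<lambda>u. a * arclength \<gamma> u + c)"
    by (intro smooth_add smooth_bilinear[OF bounded_bilinear_mult] smooth_const smooth_arclength)
  moreover have "bij (\<lambda>u. a * arclength \<gamma> u + c)"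
  proof (rule bijI)
    show "inj (\<lambda>u. a * arclength \<gamma> u + c)"
      using strict_mono_imp_inj_on[OF strict_mono_arclength] assms by (auto simp: inj_on_def)
    show "surj (\<lambda>u. a * arclength \<gamma> u + c)"
      unfolding surj_def
    proof
      fix y
      obtain u where "(y - c) / a = arclength \<gamma> u"
        using surj_arclength[OF assms(1)] by (rule surjE)
      then have "y = a * arclength \<gamma> u + c"
        using assms(2) by (simp add: field_simps)
      then show "\<exists>x. y = a * arclength \<gamma> x + c" ..
    qed
  qed
  ultimately show ?thesis
    using assms(2) speed_pos by (simp add: reparametrisation_def less_imp_neq[OF speed_pos, symmetric])
qed

section \<open>The Frenet equation and affine curvature\<close>

abbreviation tangent :: "real \<Rightarrow> real ^ 2" where
  "tangent \<equiv> d_ds \<gamma> \<gamma>"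

lemma norm_tangent: "norm (tangent u) = 1"
  using speed_pos[of u] by (simp add: d_ds_def speed_def)

text \<open>Frenet equation: the tangent has constant length, so its derivative is orthogonal to it,
  and the component along the normal is the curvature by definition.\<close>

lemma tangent_deriv:
  "(tangent has_vector_derivative (speed \<gamma> u * curvature \<gamma> u) *\<^sub>R rot90 (tangent u)) (at u)"
proof -
  let ?T' = "d_ds \<gamma> tangent u"
  have *: "(tangent has_vector_derivative speed \<gamma> u *\<^sub>R ?T') (at u)"
    by (intro d_ds_deriv smooth_d_ds smooth_curve)
  have "((\<lambda>u. tangent u \<bullet> tangent u) has_vector_derivative
      tangent u \<bullet> (speed \<gamma> u *\<^sub>R ?T') + (speed \<gamma> u *\<^sub>R ?T') \<bullet> tangent u) (at u)"
    by (rule bounded_bilinear.has_vector_derivative[OF bounded_bilinear_inner * *])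
  moreover have "(\<lambda>u. tangent u \<bullet> tangent u) = (\<lambda>u. 1)"
    using norm_tangent by (simp add: norm_eq_1)
  ultimately have "tangent u \<bullet> (speed \<gamma> u *\<^sub>R ?T') + (speed \<gamma> u *\<^sub>R ?T') \<bullet> tangent u = 0"
    by (auto dest: vector_derivative_unique_at[OF has_vector_derivative_const])
  then have "?T' \<bullet> tangent u = 0"
    using speed_pos[of u] by (simp add: inner_commute)
  moreover have "?T' \<bullet> rot90 (tangent u) = curvature \<gamma> u"
    by (simp add: curvature_def unit_normal_def rot90_def)
  ultimately have "?T' = curvature \<gamma> u *\<^sub>R rot90 (tangent u)"
    using rot90_expansion[OF norm_tangent[of u], of ?T'] by simp
  then show ?thesis
    using * by simp
qed

text \<open>Two integrations: the first gives the constant k2 as the arc length derivative of the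
  curvature, the second gives k1 as the curvature at parameter 0, where arc length vanishes.\<close>

lemma curvature_affine:
  assumes "\<And>u. curvature_ss \<gamma> u = 0"
  obtains k1 k2 where "\<And>u. curvature \<gamma> u = k2 * arclength \<gamma> u + k1"
proof -
  let ?k' = "d_ds \<gamma> (curvature \<gamma>)"
  have "(?k' has_vector_derivative 0) (at u)" for u
    using d_ds_deriv[OF smooth_d_ds[OF smooth_curvature], of u] assms[of u]
    by (simp add: curvature_ss_def)
  then obtain k2 where k2: "?k' u = k2" for u
    using has_vector_derivative_zero_constant[of UNIV ?k'] by auto
  have k: "curvature \<gamma> u = curvature \<gamma> 0 + k2 * (arclength \<gamma> u - arclength \<gamma> 0)" for u
    by (rule eq_affine_image_if_deriv_eq[OF bounded_linear_mult_right, where g' = "speed \<gamma>"])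
      (use d_ds_deriv[OF smooth_curvature] arclength_deriv in
        \<open>simp_all add: k2 has_real_derivative_iff_has_vector_derivative mult.commute\<close>)
  show ?thesis
    by (rule that[of k2 "curvature \<gamma> 0"]) (subst k, simp)
qed

text \<open>The angle of the model tangent has the same derivative as that of the tangent, so the
  components of the tangent in the moving frame of the model are constant.\<close>

lemma eq_rotated_clothoid:
  assumes k: "\<And>u. curvature \<gamma> u = k2 * arclength \<gamma> u + k1"
  obtains a b where "a\<^sup>2 + b\<^sup>2 = 1"
    "\<And>u. \<gamma> u = \<gamma> 0 + rot_mat a b *v clothoid k1 k2 (arclength \<gamma> u)"
proof -
  \<comment> \<open>The tangent of the model curve, read in the parameter of the given
    curve.\<close>
  define E where "E u = unit_at (k2 * (arclength \<gamma> u)\<^sup>2 / 2 + k1 * arclength \<gamma> u)" for u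
  have E: "(E has_vector_derivative (speed \<gamma> u * curvature \<gamma> u) *\<^sub>R rot90 (E u)) (at u)" for u
  proof -
    have "((\<lambda>u. k2 * (arclength \<gamma> u)\<^sup>2 / 2 + k1 * arclength \<gamma> u) has_real_derivative
        speed \<gamma> u * curvature \<gamma> u) (at u)"
      unfolding k using arclength_deriv[of u]
      by (auto intro!: derivative_eq_intros simp: algebra_simps)
    then show ?thesis
      unfolding E_def by (rule has_vector_derivative_unit_at)
  qed
  note rE = bounded_linear.has_vector_derivative[OF bounded_linear_rot90 E]
  note inner_deriv = bounded_bilinear.has_vector_derivative[OF bounded_bilinear_inner]
  \<comment> \<open>Both frames turn at the same rate and \<open>rot90\<close> is antisymmetric, so
    the two terms of each product rule cancel.\<close>
  have "((\<lambda>u. tangent u \<bullet> E u) has_vector_derivative 0) (at u)"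
    "((\<lambda>u. tangent u \<bullet> rot90 (E u)) has_vector_derivative 0) (at u)" for u
    using inner_deriv[OF tangent_deriv[of u] E[of u]] inner_deriv[OF tangent_deriv[of u] rE[of u]]
    by (simp_all add: plane_simps algebra_simps)
  then obtain a b where ab: "\<And>u. tangent u \<bullet> E u = a" "\<And>u. tangent u \<bullet> rot90 (E u) = b"
    using has_vector_derivative_zero_constant[of UNIV "\<lambda>u. tangent u \<bullet> E u"]
      has_vector_derivative_zero_constant[of UNIV "\<lambda>u. tangent u \<bullet> rot90 (E u)"]
    by (metis UNIV_I convex_UNIV)
  have T: "tangent u = a *\<^sub>R E u + b *\<^sub>R rot90 (E u)" for u
    using rot90_expansion[of "E u" "tangent u"] by (simp add: ab) (simp add: E_def)
  \<comment> \<open>At parameter 0 the model angle is 0, so the unit tangent there is (a,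
    b).\<close>
  have "E 0 = vector [1, 0]"
    by (simp add: E_def unit_at_def)
  then have ab1: "a\<^sup>2 + b\<^sup>2 = 1"
    using norm_tangent[of 0] unfolding T
    by (simp add: norm_eq_1 plane_simps power2_eq_square)
  have \<gamma>: "\<gamma> u = \<gamma> 0 +
      rot_mat a b *v (clothoid k1 k2 (arclength \<gamma> u) - clothoid k1 k2 (arclength \<gamma> 0))" for u
  proof (rule eq_affine_image_if_deriv_eq[where h = "(*v) (rot_mat a b)"])
    fix u
    show "((\<lambda>u. clothoid k1 k2 (arclength \<gamma> u)) has_vector_derivative speed \<gamma> u *\<^sub>R E u) (at u)"
      using vector_diff_chain_at[OF arclength_deriv[of u,
          unfolded has_real_derivative_iff_has_vector_derivative] clothoid_deriv]
      by (simp add: o_def E_def)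
    \<comment> \<open>The matrix sends E to a E + b \<open>rot90\<close> E, which is the
      tangent.\<close>
    have "rot_mat a b *v (speed \<gamma> u *\<^sub>R E u) = speed \<gamma> u *\<^sub>R tangent u"
      unfolding T by (simp add: plane_simps algebra_simps)
    then show "(\<gamma> has_vector_derivative rot_mat a b *v (speed \<gamma> u *\<^sub>R E u)) (at u)"
      using d_ds_deriv[OF smooth_curve, of u] by simp
  qed (rule matrix_vector_mul_bounded_linear)
  show ?thesis
    by (rule that[OF ab1 \<gamma>[unfolded arclength_0 clothoid_0 diff_zero]])
qed

section \<open>Excluding circles and identifying the curve\<close>

text \<open>With a the parameter at which arc length reaches L, the disjoint intervals [a,
  \<infinity>) and [0, a) would have the same image, which openness forbids.\<close>

lemma not_periodic_in_arclength:
  assumes "open_curve \<gamma>" "complete_curve \<gamma>" "L > 0"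
    and \<gamma>: "\<And>u. \<gamma> u = c (arclength \<gamma> u)"
    and per: "\<And>s n. c (s + of_int n * L) = c s"
  shows False
proof -
  obtain a where a: "L = arclength \<gamma> a"
    using surj_arclength[OF assms(2)] by (rule surjE)
  have less: "arclength \<gamma> u < arclength \<gamma> w \<longleftrightarrow> u < w" for u w
    using strict_mono_arclength by (rule strict_mono_less)
  have "{a..} \<inter> {0..<a} = {}"
    by auto
  moreover have "\<gamma> ` {a..} = \<gamma> ` {0..<a}"
  proof (intro equalityI image_subsetI)
    fix u
    \<comment> \<open>Removing n whole periods brings the arc length of u into [0, L).\<close>
    define n where "n = \<lfloor>arclength \<gamma> u / L\<rfloor>"
    obtain w where w: "arclength \<gamma> u + of_int (- n) * L = arclength \<gamma> w"
      using surj_arclength[OF assms(2)] by (rule surjE)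
    have "of_int n \<le> arclength \<gamma> u / L" "arclength \<gamma> u / L < of_int n + 1"
      unfolding n_def by linarith+
    then have "arclength \<gamma> 0 \<le> arclength \<gamma> w" "arclength \<gamma> w < arclength \<gamma> a"
      using \<open>L > 0\<close> unfolding w[symmetric] a[symmetric] by (simp_all add: field_simps)
    then have "w \<in> {0..<a}"
      using less[of w 0] less[of w a] by simp
    moreover have "\<gamma> u = \<gamma> w"
      using per[of "arclength \<gamma> u" "- n"] unfolding w by (simp only: \<gamma>[of u] \<gamma>[of w])
    ultimately show "\<gamma> u \<in> \<gamma> ` {0..<a}"
      by (intro image_eqI)
  next
    fix u
    assume "u \<in> {0..<a}"
    \<comment> \<open>Conversely, one period forward from [0, a) lands at or beyond a.\<close>
    obtain w where w: "arclength \<gamma> u + of_int 1 * L = arclength \<gamma> w"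
      using surj_arclength[OF assms(2)] by (rule surjE)
    have "\<not> arclength \<gamma> w < arclength \<gamma> a"
      using \<open>u \<in> {0..<a}\<close> less[of u 0] unfolding w[symmetric] a[symmetric] by simp
    then have "w \<in> {a..}"
      using less by simp
    moreover have "\<gamma> u = \<gamma> w"
      using per[of "arclength \<gamma> u" 1] unfolding w by (simp only: \<gamma>[of u] \<gamma>[of w])
    ultimately show "\<gamma> u \<in> \<gamma> ` {a..}"
      by (intro image_eqI)
  qed
  moreover have "emeasure lborel {a..} = \<infinity>"
    by (rule emeasure_lborel_atLeast)
  moreover have "emeasure lborel {0..<a} < \<infinity>"
    by (cases "0 \<le> a") simp_all
  moreover have "is_interval {a..}" "is_interval {0..<a}"
    by (auto simp: is_interval_1)
  ultimately show False
    using assms(1) unfolding open_curve_def by blast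
qed

lemma line_or_cornu:
  assumes "open_curve \<gamma>" "complete_curve \<gamma>" "a\<^sup>2 + b\<^sup>2 = 1"
    and \<gamma>: "\<And>u. \<gamma> u = \<gamma> 0 + rot_mat a b *v clothoid k1 k2 (arclength \<gamma> u)"
  shows "straight_line \<gamma> \<or> (\<exists>F. similarity F \<and> same_curve \<gamma> (F \<circ> cornu))"
proof (cases "k2 = 0")
  case True
  have "k1 = 0"
  proof (rule ccontr)
    assume k1: "k1 \<noteq> 0"
    show False
    proof (rule not_periodic_in_arclength[OF assms(1,2)])
      \<comment> \<open>The period must be positive while k1 may be negative; in that case n periods
        are -n multiples of 2 \<pi> / k1.\<close>
      show "\<bar>2 * pi / k1\<bar> > 0"
        using k1 by simp
      show "\<gamma> 0 + rot_mat a b *v clothoid k1 0 (s + of_int n * \<bar>2 * pi / k1\<bar>) =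
          \<gamma> 0 + rot_mat a b *v clothoid k1 0 s" for s n
        using clothoid_circle_periodic[OF k1, of s n] clothoid_circle_periodic[OF k1, of s "- n"]
        by (cases "k1 > 0") simp_all
    qed (rule \<gamma>[unfolded True])
  qed
  let ?v = "rot_mat a b *v unit_at 0"
  have "\<gamma> = (\<lambda>s. \<gamma> 0 + s *\<^sub>R ?v) \<circ> (\<lambda>u. 1 * arclength \<gamma> u + 0)"
  proof
    fix u
    show "\<gamma> u = ((\<lambda>s. \<gamma> 0 + s *\<^sub>R ?v) \<circ> (\<lambda>u. 1 * arclength \<gamma> u + 0)) u"
      using \<gamma>[of u] by (simp add: True \<open>k1 = 0\<close> clothoid_line matrix_vector_mult_scaleR)
  qed
  \<comment> \<open>This yields the nonzero direction demanded by
    \<open>straight_line\<close>.\<close>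
  moreover have "norm ?v = 1"
    by (simp add: norm_rot_mat assms(3))
  ultimately show ?thesis
    using reparametrisation_affine_arclength[OF assms(2), of 1 0]
    unfolding straight_line_def same_curve_def
    by (intro disjI1 exI[of _ "\<gamma> 0"] exI[of _ ?v] exI[of _ "\<lambda>u. 1 * arclength \<gamma> u + 0"] conjI) auto
next
  case False
  define r where "r = sqrt (\<bar>k2\<bar> / pi)"
  have r: "r > 0"
    using False by (simp add: r_def)
  obtain h where h: "linear h" "\<And>x. norm (h x) = norm x"
    and cl: "\<And>s. clothoid k1 k2 s =
      (1 / r) *\<^sub>R h (cornu (r * s + r * k1 / k2) - cornu (r * k1 / k2))"
    using clothoid_eq_cornu[OF False] unfolding r_def by blast
  \<comment> \<open>The point of the spiral at r k1/k2, which corresponds to arc length 0, is sent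
    to the initial point of the curve; the ratio is 1/r.\<close>
  define F where "F x = \<gamma> 0 + rot_mat a b *v ((1 / r) *\<^sub>R h (x - cornu (r * k1 / k2)))" for x
  have "dist (F x) (F y) = 1 / r * dist x y" for x y
  proof -
    have "F x - F y = rot_mat a b *v ((1 / r) *\<^sub>R h (x - y))"
      unfolding F_def by (simp add: linear_diff[OF h(1)] algebra_simps)
    then show ?thesis
      using r by (simp add: dist_norm norm_rot_mat[OF assms(3)] h(2))
  qed
  then have "similarity F"
    unfolding similarity_def using r by (intro exI[of _ "1 / r"]) simp
  moreover have "\<gamma> = (F \<circ> cornu) \<circ> (\<lambda>u. r * arclength \<gamma> u + r * k1 / k2)"
  proof
    fix u
    show "\<gamma> u = ((F \<circ> cornu) \<circ> (\<lambda>u. r * arclength \<gamma> u + r * k1 / k2)) u"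
      using \<gamma>[of u] cl by (simp add: F_def)
  qed
  then have "same_curve \<gamma> (F \<circ> cornu)"
    unfolding same_curve_def
    using reparametrisation_affine_arclength[OF assms(2), of r "r * k1 / k2"] r by blast
  ultimately show ?thesis
    by blast
qed

end

section \<open>Classification, and uniqueness up to rigid motion\<close>

theorem lemma3:
  fixes \<gamma> :: "real \<Rightarrow> real ^ 2"
  assumes "open_curve \<gamma>"
    and "complete_curve \<gamma>"
    and "stationary \<gamma>"
  shows "(straight_line \<gamma> \<or> (\<exists>F. similarity F \<and> same_curve \<gamma> (F \<circ> cornu))) \<and>
    (\<exists>k1 k2.
       (\<forall>u. curvature \<gamma> u = k2 * arclength \<gamma> u + k1) \<and>
       (\<forall>\<delta>. open_curve \<delta> \<and> complete_curve \<delta> \<and> stationary \<delta> \<and>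
            (\<forall>u. curvature \<delta> u = k2 * arclength \<delta> u + k1) \<longrightarrow>
            (\<exists>R b. rotation_matrix R \<and>
               (\<forall>u v. arclength \<delta> v = arclength \<gamma> u \<longrightarrow> \<delta> v = R *v \<gamma> u + b))))"
proof (intro conjI)
  interpret regular_plane_curve \<gamma>
    by standard (use assms in \<open>simp add: stationary_iff\<close>)
  obtain k1 k2 where k: "\<And>u. curvature \<gamma> u = k2 * arclength \<gamma> u + k1"
    using curvature_affine assms(3) unfolding stationary_iff by metis
  obtain a b where ab: "a\<^sup>2 + b\<^sup>2 = 1"
    and \<gamma>: "\<And>u. \<gamma> u = \<gamma> 0 + rot_mat a b *v clothoid k1 k2 (arclength \<gamma> u)"
    using eq_rotated_clothoid[OF k] by blast
  show "straight_line \<gamma> \<or> (\<exists>F. similarity F \<and> same_curve \<gamma> (F \<circ> cornu))"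
    using assms(1,2) ab \<gamma> by (rule line_or_cornu)
  show "\<exists>k1 k2. (\<forall>u. curvature \<gamma> u = k2 * arclength \<gamma> u + k1) \<and>
      (\<forall>\<delta>. open_curve \<delta> \<and> complete_curve \<delta> \<and> stationary \<delta> \<and>
        (\<forall>u. curvature \<delta> u = k2 * arclength \<delta> u + k1) \<longrightarrow>
        (\<exists>R b. rotation_matrix R \<and>
          (\<forall>u v. arclength \<delta> v = arclength \<gamma> u \<longrightarrow> \<delta> v = R *v \<gamma> u + b)))"
  proof (rule exI[of _ k1], rule exI[of _ k2], intro conjI allI impI k)
    fix \<delta>
    assume \<delta>: "open_curve \<delta> \<and> complete_curve \<delta> \<and> stationary \<delta> \<and>
      (\<forall>u. curvature \<delta> u = k2 * arclength \<delta> u + k1)"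
    then interpret \<delta>: regular_plane_curve \<delta>
      by unfold_locales (simp add: stationary_iff)
    obtain a' b' where ab': "a'\<^sup>2 + b'\<^sup>2 = 1"
      and \<delta>_eq: "\<And>v. \<delta> v = \<delta> 0 + rot_mat a' b' *v clothoid k1 k2 (arclength \<delta> v)"
      using \<delta>.eq_rotated_clothoid \<delta> by blast
    let ?M = "rot_mat a b" and ?M' = "rot_mat a' b'"
    \<comment> \<open>Both curves are rigid motions of one model; \<open>?R\<close> undoes the
      rotation of the first and applies that of the second.\<close>
    let ?R = "?M' ** transpose ?M"
    have rot: "rotation_matrix ?M" "rotation_matrix ?M'"
      using ab ab' by (simp_all add: rotation_matrix_rot_mat)
    then have "transpose ?M ** ?M = mat 1"
      by (simp add: rotation_matrix_def orthogonal_matrix_def)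
    then have R: "?R *v (?M *v x) = ?M' *v x" for x
      by (simp add: matrix_vector_mul_assoc flip: matrix_mul_assoc)
    \<comment> \<open>The translation is fixed by matching the two points at parameter 0, both of
      arc length 0.\<close>
    have "\<delta> v = ?R *v \<gamma> u + (\<delta> 0 - ?R *v \<gamma> 0)"
      if "arclength \<delta> v = arclength \<gamma> u" for u v
    proof -
      let ?x = "clothoid k1 k2 (arclength \<gamma> u)"
      have "?R *v \<gamma> u = ?R *v \<gamma> 0 + ?M' *v ?x"
        using arg_cong[OF \<gamma>[of u], of "(*v) ?R"] R by (simp add: matrix_vector_right_distrib)
      moreover have "\<delta> v = \<delta> 0 + ?M' *v ?x"
        using \<delta>_eq[of v] that by simp
      ultimately show ?thesis
        by simp
    qed
    moreover have "rotation_matrix ?R"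
      using rot by (simp add: rotation_matrix_def orthogonal_matrix_mul orthogonal_matrix_transpose det_mul)
    ultimately show "\<exists>R b. rotation_matrix R \<and>
        (\<forall>u v. arclength \<delta> v = arclength \<gamma> u \<longrightarrow> \<delta> v = R *v \<gamma> u + b)"
      by blast
  qed
qed

end
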